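(* Let $\mathcal{A}$ be a Banach algebra and let $\varphi\in\Delta(\mathcal{A})$. If $\mathcal{A}$ has an ultra central approximate identity, then $\mathcal{A}$ is $\varphi$-inner amenable.
   Context: $\Delta(\mathcal{A})$ is the set of non-zero multiplicative linear functionals on $\mathcal{A}$. $\mathcal{A}$ has an ultra central approximate identity if there is a (not necessarily bounded) net $(e_\alpha)$ in $\mathcal{A}^{**}$ such that $ae_\alpha=e_\alpha a$ for all $\alpha$ and $e_\alpha a\to a$ in norm, for every $a\in\mathcal{A}$. For $\varphi\in\Delta(\mathcal{A})$, put $\mathcal{A}_\varphi=\{a\in\mathcal{A}:\varphi(a)=1\}$. $\mathcal{A}$ is $\varphi$-inner amenable if there is a bounded linear functional $m$ on $\mathcal{A}^*$ with $m(\varphi)=1$ and $m(f\cdot a)=m(a\cdot f)$ for every $f\in\mathcal{A}^*$ and $a\in\mathcal{A}_\varphi$, where $\mathcal{A}^*$ carries the dual $\mathcal{A}$-bimodule actions. *)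

theory Defs
  imports "HOL-Analysis.Analysis"
begin

section \<open>Complex normed spaces and complex Banach algebras\<close>

text \<open>
  The library classes only provide real scalars; a complex structure extending the real one is
  added here. A Banach algebra is complex and not assumed to be unital.
\<close>

class complex_normed_vector = real_normed_vector +
  fixes scaleC :: "complex \<Rightarrow> 'a \<Rightarrow> 'a" (infixr "*\<^sub>C" 75)
  assumes scaleC_add_right: "c *\<^sub>C (x + y) = c *\<^sub>C x + c *\<^sub>C y"
    and scaleC_add_left: "(c + d) *\<^sub>C x = c *\<^sub>C x + d *\<^sub>C x"
    and scaleC_scaleC: "c *\<^sub>C d *\<^sub>C x = (c * d) *\<^sub>C x"
    and scaleR_scaleC: "r *\<^sub>R x = complex_of_real r *\<^sub>C x"
    and norm_scaleC: "norm (c *\<^sub>C x) = cmod c * norm x"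

class complex_banach_algebra = complex_normed_vector + real_normed_algebra + banach +
  assumes mult_scaleC_left: "(c *\<^sub>C x) * y = c *\<^sub>C (x * y)"
    and mult_scaleC_right: "x * (c *\<^sub>C y) = c *\<^sub>C (x * y)"


section \<open>The dual space\<close>

typedef (overloaded) 'a cdual =
  "{f :: 'a::complex_normed_vector \<Rightarrow>\<^sub>L complex.
      \<forall>c x. blinfun_apply f (c *\<^sub>C x) = c * blinfun_apply f x}"
  by (rule exI[of _ 0]) simp

setup_lifting type_definition_cdual

lift_definition cdual_apply :: "'a::complex_normed_vector cdual \<Rightarrow> 'a \<Rightarrow> complex"
  is blinfun_apply .

instantiation cdual :: (complex_normed_vector) complex_normed_vector
begin

lift_definition zero_cdual :: "'a cdual" is 0 by simp
lift_definition plus_cdual :: "'a cdual \<Rightarrow> 'a cdual \<Rightarrow> 'a cdual" is "(+)"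
  by (simp add: blinfun.add_left algebra_simps)
lift_definition minus_cdual :: "'a cdual \<Rightarrow> 'a cdual \<Rightarrow> 'a cdual" is "(-)"
  by (simp add: blinfun.diff_left algebra_simps)
lift_definition uminus_cdual :: "'a cdual \<Rightarrow> 'a cdual" is uminus
  by (simp add: blinfun.minus_left)
lift_definition scaleR_cdual :: "real \<Rightarrow> 'a cdual \<Rightarrow> 'a cdual" is scaleR
  by (simp add: blinfun.scaleR_left)
lift_definition scaleC_cdual :: "complex \<Rightarrow> 'a cdual \<Rightarrow> 'a cdual"
  is "\<lambda>c f. blinfun_mult_right c o\<^sub>L f"
  by (simp add: algebra_simps)
lift_definition norm_cdual :: "'a cdual \<Rightarrow> real" is norm .
definition dist_cdual :: "'a cdual \<Rightarrow> 'a cdual \<Rightarrow> real"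
  where "dist_cdual f g = norm (f - g)"
definition sgn_cdual :: "'a cdual \<Rightarrow> 'a cdual"
  where "sgn_cdual f = inverse (norm f) *\<^sub>R f"
definition [code del]:
  "(uniformity :: ('a cdual \<times> 'a cdual) filter) = (INF e\<in>{0 <..}. principal {(f, g). dist f g < e})"
definition open_cdual :: "'a cdual set \<Rightarrow> bool"
  where [code del]:
    "open_cdual S = (\<forall>f\<in>S. \<forall>\<^sub>F (f', g) in uniformity. f' = f \<longrightarrow> g \<in> S)"

instance
proof
  fix f g h :: "'a cdual" and r s :: real and c d :: complex
  show "f + g + h = f + (g + h)" "f + g = g + f" "0 + f = f" "- f + f = 0" "f - g = f + - g"
    by (transfer, simp)+
  show "r *\<^sub>R (f + g) = r *\<^sub>R f + r *\<^sub>R g" "(r + s) *\<^sub>R f = r *\<^sub>R f + s *\<^sub>R f"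
    "r *\<^sub>R s *\<^sub>R f = (r * s) *\<^sub>R f" "1 *\<^sub>R f = f"
    by (transfer, simp add: algebra_simps)+
  show "dist f g = norm (f - g)" by (rule dist_cdual_def)
  show "sgn f = inverse (norm f) *\<^sub>R f" by (rule sgn_cdual_def)
  show "(uniformity :: ('a cdual \<times> 'a cdual) filter) =
      (INF e\<in>{0 <..}. principal {(f, g). dist f g < e})"
    by (rule uniformity_cdual_def)
  show "open S = (\<forall>f\<in>S. \<forall>\<^sub>F (f', g) in uniformity. f' = f \<longrightarrow> g \<in> S)" for S :: "'a cdual set"
    by (rule open_cdual_def)
  show "(norm f = 0) = (f = 0)" by transfer simp
  show "norm (f + g) \<le> norm f + norm g" by transfer (rule norm_triangle_ineq)
  show "norm (r *\<^sub>R f) = \<bar>r\<bar> * norm f" by transfer simp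
  show "c *\<^sub>C (f + g) = c *\<^sub>C f + c *\<^sub>C g" "(c + d) *\<^sub>C f = c *\<^sub>C f + d *\<^sub>C f"
    "c *\<^sub>C d *\<^sub>C f = (c * d) *\<^sub>C f"
    by (transfer, rule blinfun_eqI, simp add: blinfun.bilinear_simps algebra_simps)+
  show "r *\<^sub>R f = complex_of_real r *\<^sub>C f"
    by (transfer, rule blinfun_eqI) (simp add: blinfun.bilinear_simps scaleR_conv_of_real)
  have le: "norm (c *\<^sub>C f) \<le> cmod c * norm f" for c and f :: "'a cdual"
  proof transfer
    fix c and f :: "'a \<Rightarrow>\<^sub>L complex"
    show "norm (blinfun_mult_right c o\<^sub>L f) \<le> cmod c * norm f"
    proof (rule norm_blinfun_bound)
      fix x
      show "cmod (blinfun_apply (blinfun_mult_right c o\<^sub>L f) x) \<le> cmod c * norm f * norm x"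
        using mult_left_mono[OF norm_blinfun[of f x], of "cmod c"]
        by (simp add: norm_mult mult.assoc)
    qed simp
  qed
  show "norm (c *\<^sub>C f) = cmod c * norm f"
  proof (cases "c = 0")
    case True
    have "0 *\<^sub>C f = 0"
      by (transfer, rule blinfun_eqI) simp
    moreover have "norm (0 :: 'a cdual) = 0"
      by transfer simp
    ultimately show ?thesis using True by simp
  next
    case False
    have "inverse c *\<^sub>C c *\<^sub>C f = f"
      using False
      by (transfer, intro blinfun_eqI) simp
    then have "norm f \<le> cmod (inverse c) * norm (c *\<^sub>C f)"
      using le[of "inverse c" "c *\<^sub>C f"] by simp
    then have "cmod c * norm f \<le> norm (c *\<^sub>C f)"
      using False by (simp add: norm_inverse norm_divide field_simps)
    with le[of c f] show ?thesis by simp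
  qed
qed

end

lemma cdual_eqI: "(\<And>x. cdual_apply f x = cdual_apply g x) \<Longrightarrow> f = g"
  by transfer (rule blinfun_eqI)

lemma bounded_bilinear_cdual_apply: "bounded_bilinear cdual_apply"
proof
  fix f g :: "'a cdual" and a b :: 'a and r :: real
  show "cdual_apply (f + g) a = cdual_apply f a + cdual_apply g a"
    "cdual_apply f (a + b) = cdual_apply f a + cdual_apply f b"
    "cdual_apply (r *\<^sub>R f) a = r *\<^sub>R cdual_apply f a"
    "cdual_apply f (r *\<^sub>R a) = r *\<^sub>R cdual_apply f a"
    by (transfer, simp add: blinfun.bilinear_simps)+
  show "\<exists>K. \<forall>(f :: 'a cdual) a. norm (cdual_apply f a) \<le> norm f * norm a * K"
    by (rule exI[of _ 1], transfer) (simp add: norm_blinfun)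
qed

interpretation cdual: bounded_bilinear cdual_apply
  by (rule bounded_bilinear_cdual_apply)

lemma norm_cdual_apply: "cmod (cdual_apply f x) \<le> norm f * norm x"
  by transfer (rule norm_blinfun)

lemma norm_cdual_eq_onorm: "norm f = onorm (cdual_apply f)"
  by transfer (rule norm_blinfun.rep_eq)

lemma cdual_apply_scaleC_right: "cdual_apply f (c *\<^sub>C x) = c * cdual_apply f x"
  by transfer simp

lemma cdual_apply_scaleC_left: "cdual_apply (c *\<^sub>C f) x = c * cdual_apply f x"
  by transfer simp

definition bounded_clinear :: "('a::complex_normed_vector \<Rightarrow> complex) \<Rightarrow> bool"
  where "bounded_clinear f \<longleftrightarrow> bounded_linear f \<and> (\<forall>c x. f (c *\<^sub>C x) = c * f x)"

text \<open>
  The element of the dual space given by a function; meaningful only for arguments satisfying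
  \<^const>\<open>bounded_clinear\<close>. Each use below is accompanied by a proof of this condition.
\<close>

definition Cdual :: "('a::complex_normed_vector \<Rightarrow> complex) \<Rightarrow> 'a cdual"
  where "Cdual f = Abs_cdual (Blinfun f)"

lemma bounded_clinear_cdual_apply: "bounded_clinear (cdual_apply f)"
  by (simp add: bounded_clinear_def cdual.bounded_linear_right cdual_apply_scaleC_right)

lemma cdual_apply_Cdual: "bounded_clinear f \<Longrightarrow> cdual_apply (Cdual f) = f"
  by (simp add: bounded_clinear_def Cdual_def cdual_apply.rep_eq Abs_cdual_inverse
      bounded_linear_Blinfun_apply)

lemma bounded_clinear_compose:
  assumes "bounded_linear g" and "\<And>c x. g (c *\<^sub>C x) = c *\<^sub>C g x"
  shows "bounded_clinear (\<lambda>x. cdual_apply f (g x))"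
  using assms
  by (auto simp: bounded_clinear_def cdual_apply_scaleC_right
      intro!: bounded_linear_compose[OF cdual.bounded_linear_right])


section \<open>Module actions on the dual and on the second dual\<close>

text \<open>
  \<open>(a \<cdot> f)(b) = f (b a)\<close> and \<open>(f \<cdot> a)(b) = f (a b)\<close>.
\<close>

definition dual_lact :: "'a::complex_banach_algebra \<Rightarrow> 'a cdual \<Rightarrow> 'a cdual"
  where "dual_lact a f = Cdual (\<lambda>b. cdual_apply f (b * a))"

definition dual_ract :: "'a::complex_banach_algebra cdual \<Rightarrow> 'a \<Rightarrow> 'a cdual"
  where "dual_ract f a = Cdual (\<lambda>b. cdual_apply f (a * b))"

lemma dual_lact_apply: "cdual_apply (dual_lact a f) b = cdual_apply f (b * a)"
  unfolding dual_lact_def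
  by (subst cdual_apply_Cdual)
    (auto intro!: bounded_clinear_compose bounded_linear_mult_left simp: mult_scaleC_left)

lemma dual_ract_apply: "cdual_apply (dual_ract f a) b = cdual_apply f (a * b)"
  unfolding dual_ract_def
  by (subst cdual_apply_Cdual)
    (auto intro!: bounded_clinear_compose bounded_linear_mult_right simp: mult_scaleC_right)

lemma norm_dual_lact: "norm (dual_lact a f) \<le> norm f * norm a"
  unfolding norm_cdual_eq_onorm[of "dual_lact a f"]
proof (rule onorm_bound)
  show "cmod (cdual_apply (dual_lact a f) b) \<le> norm f * norm a * norm b" for b
    using order_trans[OF norm_cdual_apply[of f "b * a"]
        mult_left_mono[OF norm_mult_ineq[of b a] norm_ge_zero[of f]]]
    by (simp add: dual_lact_apply ac_simps)
qed simp

lemma norm_dual_ract: "norm (dual_ract f a) \<le> norm f * norm a"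
  unfolding norm_cdual_eq_onorm[of "dual_ract f a"]
proof (rule onorm_bound)
  show "cmod (cdual_apply (dual_ract f a) b) \<le> norm f * norm a * norm b" for b
    using order_trans[OF norm_cdual_apply[of f "a * b"]
        mult_left_mono[OF norm_mult_ineq[of a b] norm_ge_zero[of f]]]
    by (simp add: dual_ract_apply ac_simps)
qed simp

lemma bounded_linear_dual_lact: "bounded_linear (dual_lact a)"
  by (rule bounded_linear_intro[where K = "norm a"])
    (auto intro!: cdual_eqI simp: dual_lact_apply cdual.add_left cdual.scaleR_left norm_dual_lact)

lemma bounded_linear_dual_ract: "bounded_linear (\<lambda>f. dual_ract f a)"
  by (rule bounded_linear_intro[where K = "norm a"])
    (auto intro!: cdual_eqI simp: dual_ract_apply cdual.add_left cdual.scaleR_left norm_dual_ract)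

text \<open>
  \<open>(a \<cdot> F)(f) = F (f \<cdot> a)\<close> and \<open>(F \<cdot> a)(f) = F (a \<cdot> f)\<close>.
\<close>

definition bidual_lact :: "'a::complex_banach_algebra \<Rightarrow> 'a cdual cdual \<Rightarrow> 'a cdual cdual"
  where "bidual_lact a F = Cdual (\<lambda>f. cdual_apply F (dual_ract f a))"

definition bidual_ract :: "'a::complex_banach_algebra cdual cdual \<Rightarrow> 'a \<Rightarrow> 'a cdual cdual"
  where "bidual_ract F a = Cdual (\<lambda>f. cdual_apply F (dual_lact a f))"

lemma bidual_lact_apply: "cdual_apply (bidual_lact a F) f = cdual_apply F (dual_ract f a)"
  unfolding bidual_lact_def
  by (subst cdual_apply_Cdual)
    (auto intro!: bounded_clinear_compose bounded_linear_dual_ract cdual_eqI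
      simp: dual_ract_apply cdual_apply_scaleC_left)

lemma bidual_ract_apply: "cdual_apply (bidual_ract F a) f = cdual_apply F (dual_lact a f)"
  unfolding bidual_ract_def
  by (subst cdual_apply_Cdual)
    (auto intro!: bounded_clinear_compose bounded_linear_dual_lact cdual_eqI
      simp: dual_lact_apply cdual_apply_scaleC_left)

definition bidual_embed :: "'a::complex_normed_vector \<Rightarrow> 'a cdual cdual"
  where "bidual_embed a = Cdual (\<lambda>f. cdual_apply f a)"

lemma bidual_embed_apply: "cdual_apply (bidual_embed a) f = cdual_apply f a"
  unfolding bidual_embed_def
  by (subst cdual_apply_Cdual)
    (auto simp: bounded_clinear_def cdual.bounded_linear_left cdual_apply_scaleC_left)


section \<open>Characters\<close>

text \<open>
  Continuity is not part of the definition; it is automatic, as shown below.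
\<close>

definition characters :: "('a::complex_banach_algebra \<Rightarrow> complex) set" ("\<Delta>")
  where "\<Delta> = {\<phi>. (\<forall>x y. \<phi> (x + y) = \<phi> x + \<phi> y) \<and> (\<forall>c x. \<phi> (c *\<^sub>C x) = c * \<phi> x) \<and>
                (\<forall>x y. \<phi> (x * y) = \<phi> x * \<phi> y) \<and> (\<exists>x. \<phi> x \<noteq> 0)}"

lemma character_norm_le:
  fixes a :: "'a::complex_banach_algebra"
  assumes "\<phi> \<in> \<Delta>"
  shows "cmod (\<phi> a) \<le> norm a"
proof (rule ccontr)
  assume "\<not> cmod (\<phi> a) \<le> norm a"
  then have lt: "norm a < cmod (\<phi> a)" by simp
  then have nz: "\<phi> a \<noteq> 0" by auto
  define b where "b = inverse (\<phi> a) *\<^sub>C a"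
  have b1: "\<phi> b = 1"
    using assms nz by (simp add: b_def characters_def)
  have nb: "norm b < 1"
    using lt nz by (simp add: b_def norm_scaleC norm_inverse norm_divide divide_simps)
  define p where "p n = ((\<lambda>x. b * x) ^^ n) b" for n
  have pS: "p (Suc n) = b * p n" for n by (simp add: p_def)
  have pn: "norm (p n) \<le> norm b * norm b ^ n" for n
  proof (induction n)
    case (Suc n)
    have "norm (p (Suc n)) \<le> norm b * norm (p n)"
      unfolding pS by (rule norm_mult_ineq)
    also have "\<dots> \<le> norm b * (norm b * norm b ^ n)"
      by (rule mult_left_mono[OF Suc]) simp
    finally show ?case by simp
  qed (simp add: p_def)
  have sp: "summable p"
    by (rule summable_comparison_test'[where g = "\<lambda>n. norm b * norm b ^ n" and N = 0])
      (use nb pn in \<open>auto intro!: summable_mult summable_geometric\<close>)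
  define s where "s = suminf p"
  have "b + b * s = s"
  proof -
    have "(\<Sum>n. p (Suc n)) = b * s"
      unfolding pS s_def by (rule suminf_mult[OF sp])
    moreover have "(\<Sum>n. p (Suc n)) = s - b"
      unfolding s_def by (subst suminf_split_head[OF sp]) (simp add: p_def)
    ultimately show ?thesis by (simp add: algebra_simps)
  qed
  then have "\<phi> b + \<phi> b * \<phi> s = \<phi> s"
    using assms by (auto simp: characters_def) metis
  with b1 show False by simp
qed

lemma character_bounded_clinear:
  assumes "\<phi> \<in> \<Delta>"
  shows "bounded_clinear \<phi>"
  unfolding bounded_clinear_def
proof
  show "bounded_linear \<phi>"
    by (rule bounded_linear_intro[where K = 1])
      (use assms character_norm_le[OF assms] in
        \<open>auto simp: characters_def scaleR_scaleC scaleR_conv_of_real\<close>)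
qed (use assms in \<open>simp add: characters_def\<close>)


section \<open>Nets\<close>

definition directed_set :: "'i set \<Rightarrow> ('i \<Rightarrow> 'i \<Rightarrow> bool) \<Rightarrow> bool"
  where "directed_set I le \<longleftrightarrow> I \<noteq> {} \<and> reflp_on I le \<and> transp_on I le \<and>
           (\<forall>i\<in>I. \<forall>j\<in>I. \<exists>k\<in>I. le i k \<and> le j k)"

definition net_filter :: "'i set \<Rightarrow> ('i \<Rightarrow> 'i \<Rightarrow> bool) \<Rightarrow> 'i filter"
  where "net_filter I le = (INF i\<in>I. principal {j \<in> I. le i j})"

lemma eventually_net_filter:
  assumes "directed_set I le"
  shows "eventually P (net_filter I le) \<longleftrightarrow> (\<exists>i\<in>I. \<forall>j\<in>I. le i j \<longrightarrow> P j)"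
  unfolding net_filter_def
proof (subst eventually_INF_base)
  show "I \<noteq> {}" using assms by (simp add: directed_set_def)
  fix i j assume ij: "i \<in> I" "j \<in> I"
  then obtain k where k: "k \<in> I" "le i k" "le j k"
    using assms by (auto simp: directed_set_def)
  have "le i l \<and> le j l" if "l \<in> I" "le k l" for l
    using assms ij k that by (auto simp: directed_set_def dest: transp_onD)
  then show "\<exists>x\<in>I. principal {j \<in> I. le x j} \<le> inf (principal {j \<in> I. le i j}) (principal {k \<in> I. le j k})"
    using k(1) by (intro bexI[of _ k]) auto
qed (auto simp: eventually_principal)


section \<open>Ultra central approximate identities and inner amenability\<close>

definition ultra_central_approximate_identity ::
    "'i set \<Rightarrow> ('i \<Rightarrow> 'i \<Rightarrow> bool) \<Rightarrow> ('i \<Rightarrow> 'a::complex_banach_algebra cdual cdual) \<Rightarrow> bool"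
  where "ultra_central_approximate_identity I le e \<longleftrightarrow>
           directed_set I le \<and>
           (\<forall>a. \<forall>i\<in>I. bidual_lact a (e i) = bidual_ract (e i) a) \<and>
           (\<forall>a. ((\<lambda>i. bidual_ract (e i) a) \<longlongrightarrow> bidual_embed a) (net_filter I le))"

definition inner_amenable :: "('a::complex_banach_algebra \<Rightarrow> complex) \<Rightarrow> bool"
  where "inner_amenable \<phi> \<longleftrightarrow>
           (\<exists>m :: 'a cdual cdual. cdual_apply m (Cdual \<phi>) = 1 \<and>
              (\<forall>f. \<forall>a\<in>{a. \<phi> a = 1}.
                 cdual_apply m (dual_ract f a) = cdual_apply m (dual_lact a f)))"

end

theory Submission
  imports Defs
begin

text \<open>
  A single \<open>e\<^sub>i\<close> of the net, suitably normalised, witnesses inner amenability. Commuting with every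
  \<open>a\<close> means \<open>e\<^sub>i (f \<cdot> a) = (a \<cdot> e\<^sub>i)(f) = (e\<^sub>i \<cdot> a)(f) = e\<^sub>i (a \<cdot> f)\<close>, which is the invariance that
  is wanted, so all that remains is to find an \<open>i\<close> with \<open>e\<^sub>i \<phi> \<noteq> 0\<close>, by which \<open>e\<^sub>i\<close> can be divided.
  Since \<open>\<phi>\<close> is a character, \<open>a \<cdot> \<phi> = \<phi>(a) \<phi>\<close>, whence \<open>(e\<^sub>i \<cdot> a)(\<phi>) = \<phi> a * e\<^sub>i \<phi>\<close>. For \<open>a\<close> with
  \<open>\<phi> a \<noteq> 0\<close> the left-hand side tends to \<open>\<phi> a\<close>, so \<open>e\<^sub>i \<phi>\<close> is eventually non-zero.
\<close>

lemma dual_lact_character: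
  assumes "\<phi> \<in> \<Delta>"
  shows "dual_lact a (Cdual \<phi>) = \<phi> a *\<^sub>C Cdual \<phi>"
  using assms
  by (intro cdual_eqI)
    (simp add: dual_lact_apply cdual_apply_scaleC_left
      cdual_apply_Cdual[OF character_bounded_clinear] characters_def)

lemma net_filter_neq_bot:
  assumes "directed_set I le"
  shows "net_filter I le \<noteq> bot"
  using assms
  by (auto simp: trivial_limit_def eventually_net_filter[OF assms] directed_set_def
      dest: reflp_onD)

lemma eventually_net_filter_in_index:
  assumes "directed_set I le"
  shows "\<forall>\<^sub>F i in net_filter I le. i \<in> I"
  using assms by (auto simp: eventually_net_filter directed_set_def)

text \<open>
  Choose \<open>a\<close> with \<open>\<phi> a \<noteq> 0\<close> and evaluate \<open>e\<^sub>i \<cdot> a \<rightarrow> a\<close> at \<open>\<phi>\<close>: the numbers \<open>\<phi> a * e\<^sub>i \<phi>\<close> have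
  the non-zero limit \<open>\<phi> a\<close>.
\<close>

lemma ultra_central_approximate_identity_nonzero_at_character:
  assumes \<phi>: "\<phi> \<in> \<Delta>"
    and e: "ultra_central_approximate_identity I le e"
  obtains i where "i \<in> I" "cdual_apply (e i) (Cdual \<phi>) \<noteq> 0"
proof -
  have dir: "directed_set I le"
    and conv: "((\<lambda>i. bidual_ract (e i) a) \<longlongrightarrow> bidual_embed a) (net_filter I le)" for a
    using e by (simp_all add: ultra_central_approximate_identity_def)
  obtain a where a: "\<phi> a \<noteq> 0"
    using \<phi> by (auto simp: characters_def)
  have "((\<lambda>i. cdual_apply (bidual_ract (e i) a) (Cdual \<phi>)) \<longlongrightarrow>
      cdual_apply (bidual_embed a) (Cdual \<phi>)) (net_filter I le)"
    by (intro cdual.tendsto conv tendsto_const)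
  then have "((\<lambda>i. \<phi> a * cdual_apply (e i) (Cdual \<phi>)) \<longlongrightarrow> \<phi> a) (net_filter I le)"
    by (simp add: bidual_ract_apply dual_lact_character[OF \<phi>] cdual_apply_scaleC_right
        bidual_embed_apply cdual_apply_Cdual[OF character_bounded_clinear[OF \<phi>]])
  then have "\<forall>\<^sub>F i in net_filter I le. \<phi> a * cdual_apply (e i) (Cdual \<phi>) \<noteq> 0"
    using a by (rule tendsto_imp_eventually_ne)
  then have "\<forall>\<^sub>F i in net_filter I le. i \<in> I \<and> cdual_apply (e i) (Cdual \<phi>) \<noteq> 0"
    using eventually_net_filter_in_index[OF dir] by eventually_elim simp
  then show thesis
    using that eventually_happens'[OF net_filter_neq_bot[OF dir]] by blast
qed

theorem corollary5p2:
  fixes \<phi> :: "'a::complex_banach_algebra \<Rightarrow> complex"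
    and I :: "'i set" and le :: "'i \<Rightarrow> 'i \<Rightarrow> bool" and e :: "'i \<Rightarrow> 'a cdual cdual"
  assumes "\<phi> \<in> \<Delta>"
    and "ultra_central_approximate_identity I le e"
  shows "inner_amenable \<phi>"
proof -
  obtain i where i: "i \<in> I" and nz: "cdual_apply (e i) (Cdual \<phi>) \<noteq> 0"
    using ultra_central_approximate_identity_nonzero_at_character[OF assms] .
  define m where "m = inverse (cdual_apply (e i) (Cdual \<phi>)) *\<^sub>C e i"
  have "cdual_apply m (Cdual \<phi>) = 1"
    using nz by (simp add: m_def cdual_apply_scaleC_left)
  moreover have "cdual_apply m (dual_ract f a) = cdual_apply m (dual_lact a f)" for f a
  proof -
    have "bidual_lact a (e i) = bidual_ract (e i) a"
      using assms(2) i by (simp add: ultra_central_approximate_identity_def)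
    then have "cdual_apply (e i) (dual_ract f a) = cdual_apply (e i) (dual_lact a f)"
      by (metis bidual_lact_apply bidual_ract_apply)
    then show ?thesis
      by (simp add: m_def cdual_apply_scaleC_left)
  qed
  ultimately show ?thesis
    unfolding inner_amenable_def by blast
qed

end
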